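(* For every prime power $q\ge 9$ the strict inequality $A(3,q)<M(3,q)$ holds.
   Context: Let $q$ be a prime power and $V$ an $n$-dimensional vector space over $\mathrm{GF}(q)$. An unknown $1$-dimensional subspace $\mathbf{v}$ of $V$ is to be found using queries that are subspaces $U$ of $V$; the answer to query $U$ is YES if $\mathbf{v}\le U$ and NO otherwise. $A(n,q)$ is the minimum number of queries needed in the worst case in adaptive search (later queries may depend on earlier answers). $M(n,q)$ is the minimum number of queries needed in non-adaptive search (all queries fixed in advance); equivalently, $M(n,q)$ is the minimum size of a family $\mathcal{U}$ of subspaces of $V$ that is separating, i.e. for every two distinct $1$-subspaces $\mathbf{u},\mathbf{v}$ of $V$ there is $U\in\mathcal{U}$ containing exactly one of $\mathbf{u},\mathbf{v}$. *)

theory Defs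
  imports "HOL-Analysis.Analysis" "HOL-Number_Theory.Number_Theory"
begin

text \<open>
  An adaptive strategy is a decision tree: a leaf announces the subspace found, and
  \<open>Ask U s t\<close> queries \<open>U\<close>, continuing with \<open>s\<close> on YES and with \<open>t\<close> on NO.
\<close>

datatype 'v strategy = Announce "'v set" | Ask "'v set" "'v strategy" "'v strategy"

primrec queries :: "'v strategy \<Rightarrow> 'v set set" where
  "queries (Announce w) = {}"
| "queries (Ask U s t) = insert U (queries s \<union> queries t)"

primrec outcome :: "'v strategy \<Rightarrow> 'v set \<Rightarrow> 'v set" where
  "outcome (Announce w) v = w"
| "outcome (Ask U s t) v = (if v \<subseteq> U then outcome s v else outcome t v)"

primrec num_queries :: "'v strategy \<Rightarrow> 'v set \<Rightarrow> nat" where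
  "num_queries (Announce w) v = 0"
| "num_queries (Ask U s t) v =
     Suc (if v \<subseteq> U then num_queries s v else num_queries t v)"

text \<open>
  In what follows, \<open>smul\<close> is the scalar multiplication of a vector space whose carrier is
  the whole type \<open>'v\<close>.
\<close>

definition one_subspaces :: "('k::field \<Rightarrow> 'v::ab_group_add \<Rightarrow> 'v) \<Rightarrow> 'v set set" where
  "one_subspaces smul = {v. module.subspace smul v \<and> vector_space.dim smul v = 1}"

definition finds_all :: "('k::field \<Rightarrow> 'v::ab_group_add \<Rightarrow> 'v) \<Rightarrow> 'v strategy \<Rightarrow> bool" where
  "finds_all smul s \<longleftrightarrow>
     (\<forall>U\<in>queries s. module.subspace smul U) \<and>
     (\<forall>v\<in>one_subspaces smul. outcome s v = v)"

definition adaptive_number :: "('k::field \<Rightarrow> 'v::ab_group_add \<Rightarrow> 'v) \<Rightarrow> nat" where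
  "adaptive_number smul =
     (LEAST k. \<exists>s. finds_all smul s \<and>
        (\<forall>v\<in>one_subspaces smul. num_queries s v \<le> k))"

definition separating :: "('k::field \<Rightarrow> 'v::ab_group_add \<Rightarrow> 'v) \<Rightarrow> 'v set set \<Rightarrow> bool" where
  "separating smul \<U> \<longleftrightarrow>
     (\<forall>u\<in>one_subspaces smul. \<forall>v\<in>one_subspaces smul. u \<noteq> v \<longrightarrow>
        (\<exists>U\<in>\<U>. (u \<subseteq> U) \<noteq> (v \<subseteq> U)))"

definition nonadaptive_number :: "('k::field \<Rightarrow> 'v::ab_group_add \<Rightarrow> 'v) \<Rightarrow> nat" where
  "nonadaptive_number smul =
     (LEAST k. \<exists>\<U>. finite \<U> \<and> card \<U> = k \<and>
        (\<forall>U\<in>\<U>. module.subspace smul U) \<and> separating smul \<U>)"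

end

theory Submission
  imports Defs
begin

text \<open>
  Adaptively, \<open>2q - 1\<close> queries suffice: ask the lines through a fixed point \<open>p\<close> one after another
  until the line of the unknown point is known, then search that line point by point. Only if the
  first answer is YES can \<open>p\<close> itself still be a candidate.

  Non-adaptively, \<open>2q - 1\<close> queries do not suffice. Suppose they consist of \<open>a\<close> points and \<open>b\<close>
  lines, and let \<open>t x\<close> be the number of query lines through \<open>x\<close>. Separation forces \<open>t \<ge> 2\<close> outside
  a set of at most \<open>a + b + 1\<close> points, so that \<open>t\<close> has average about \<open>2\<close> and total excess
  \<open>\<Sum>(t - 2)\<close> over the points with \<open>t > 2\<close> of order \<open>q\<close>. Any two query lines meet, whence
  \<open>\<Sum>t(t - 1) \<ge> b(b - 1)\<close>, which makes \<open>\<Sum>(t - 2)(t + 1)\<close> of order \<open>2q\<^sup>2\<close> when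
  \<open>b\<close> is near \<open>2q\<close>. As \<open>t \<le> q + 1\<close>, this is too large for the excess.
\<close>

section \<open>Counting in incidence structures\<close>

lemma sum_card_swap:
  assumes "finite X" "finite L"
  shows "(\<Sum>x\<in>X. card {l\<in>L. R x l}) = (\<Sum>l\<in>L. card {x\<in>X. R x l})"
  unfolding card_eq_sum by (rule sum.swap_restrict[OF assms])

text \<open>Double counting of triples made of an ordered pair of distinct blocks and a common
  point. Each pair has at least one such point, while a point on \<open>d\<close> blocks lies in
  \<open>d * (d - 1)\<close> triples.\<close>

lemma sum_degree_mult_pred_ge:
  fixes R :: "'a \<Rightarrow> 'b \<Rightarrow> bool"
  assumes fin: "finite X" "finite L"
    and meet: "\<And>l m. l \<in> L \<Longrightarrow> m \<in> L \<Longrightarrow> l \<noteq> m \<Longrightarrow> \<exists>x\<in>X. R x l \<and> R x m"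
  shows "card L * (card L - 1) \<le> (\<Sum>x\<in>X. card {l\<in>L. R x l} * (card {l\<in>L. R x l} - 1))"
proof -
  have "card L * (card L - 1) = (\<Sum>l\<in>L. \<Sum>m\<in>L - {l}. 1)"
    using fin by simp
  also have "\<dots> \<le> (\<Sum>l\<in>L. \<Sum>m\<in>L - {l}. card {x\<in>{x\<in>X. R x l}. R x m})"
  proof (intro sum_mono)
    fix l m assume "l \<in> L" "m \<in> L - {l}"
    then obtain x where "x \<in> {x\<in>{x\<in>X. R x l}. R x m}"
      using meet[of l m] by auto
    then have "card {x\<in>{x\<in>X. R x l}. R x m} > 0"
      using fin by (intro card_gt_0_iff[THEN iffD2]) auto
    then show "1 \<le> card {x\<in>{x\<in>X. R x l}. R x m}" by simp
  qed
  also have "\<dots> = (\<Sum>l\<in>L. \<Sum>x\<in>{x\<in>X. R x l}. card {m\<in>L - {l}. R x m})"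
    using fin by (intro sum.cong refl sum_card_swap[symmetric]) auto
  also have "\<dots> = (\<Sum>x\<in>X. \<Sum>l\<in>{l\<in>L. R x l}. card {m\<in>L - {l}. R x m})"
    by (rule sum.swap_restrict[OF fin, symmetric])
  also have "\<dots> = (\<Sum>x\<in>X. \<Sum>l\<in>{l\<in>L. R x l}. card {l\<in>L. R x l} - 1)"
  proof (intro sum.cong refl)
    fix x l assume l: "l \<in> {l\<in>L. R x l}"
    have "{m\<in>L - {l}. R x m} = {l\<in>L. R x l} - {l}" by auto
    then show "card {m\<in>L - {l}. R x m} = card {l\<in>L. R x l} - 1"
      using l fin by simp
  qed
  finally show ?thesis by simp
qed

text \<open>Here \<open>L\<close> and \<open>P\<close> are the query lines and query points. A point
  outside \<open>P\<close> is known only by the set of query lines through it, so separation becomes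
  injectivity on \<open>X - P\<close>. The hypothesis \<open>q \<ge> 3\<close> makes the term
  \<open>(Q - 2) * (Q - 2)\<close> of the final inequality strictly positive.\<close>

lemma separating_points_and_lines_ge:
  fixes R :: "'a \<Rightarrow> 'b \<Rightarrow> bool" and q :: nat
  assumes fin: "finite X" "finite L" "finite P"
    and q: "q \<ge> 3"
    and card_X: "card X \<ge> q\<^sup>2 + q + 1"
    and points_on: "\<And>l. l \<in> L \<Longrightarrow> card {x\<in>X. R x l} \<le> q + 1"
    and lines_through: "\<And>x. x \<in> X \<Longrightarrow> card {l\<in>L. R x l} \<le> q + 1"
    and meet: "\<And>l m. l \<in> L \<Longrightarrow> m \<in> L \<Longrightarrow> l \<noteq> m \<Longrightarrow> \<exists>x\<in>X. R x l \<and> R x m"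
    and sep: "inj_on (\<lambda>x. {l\<in>L. R x l}) (X - P)"
  shows "2 * q \<le> card P + card L"
proof (rule ccontr)
  assume "\<not> 2 * q \<le> card P + card L"
  then have less: "card P + card L + 1 \<le> 2 * q" by simp
  define T where "T x = {l\<in>L. R x l}" for x
  define t where "t x = int (card (T x))" for x
  define a b where "a = int (card P)" and "b = int (card L)"
  \<comment> \<open>Points with \<open>t x = 0\<close> are counted in both numbers; the two
    correction terms below rely on this.\<close>
  define n0 n1 where "n0 = int (card {x\<in>X. t x = 0})" and "n1 = int (card {x\<in>X. t x \<le> 1})"
  have fin_T: "finite (T x)" for x using fin by (simp add: T_def)
  have ab: "a \<ge> 0" "b \<ge> 0" "a + b + 1 \<le> 2 * int q"
    using less by (auto simp: a_def b_def)

  \<comment> \<open>Outside \<open>P\<close> each value of \<open>T\<close> is taken at most once,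
    and the points of \<open>P\<close> add at most \<open>a\<close>. This is applied to the empty
    set of lines, and then to that set together with all singletons.\<close>
  have bound: "int (card {x\<in>X. Q x}) \<le> a + int (card F)"
    if "finite F" "\<And>x. x \<in> X \<Longrightarrow> Q x \<Longrightarrow> T x \<in> F" for Q F
  proof -
    have "card ({x\<in>X. Q x} - P) \<le> card F"
    proof (rule card_inj_on_le[of T])
      show "inj_on T ({x\<in>X. Q x} - P)"
        using sep unfolding T_def by (rule inj_on_subset) auto
    qed (use that in auto)
    moreover have "card {x\<in>X. Q x} \<le> card (P \<union> ({x\<in>X. Q x} - P))"
      using fin by (intro card_mono) auto
    moreover have "\<dots> \<le> card P + card ({x\<in>X. Q x} - P)"
      by (rule card_Un_le)
    ultimately show ?thesis by (simp add: a_def)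
  qed
  have n0: "n0 \<le> a + 1"
    using bound[of "{{}}" "\<lambda>x. t x = 0"] fin_T by (simp add: n0_def t_def)
  have "n1 \<le> a + int (card (insert {} ((\<lambda>l. {l}) ` L)))"
    unfolding n1_def
  proof (rule bound)
    fix x assume "t x \<le> 1"
    then have "card (T x) = 0 \<or> card (T x) = 1" by (auto simp: t_def)
    then show "T x \<in> insert {} ((\<lambda>l. {l}) ` L)"
      using fin_T[of x] by (auto simp: card_1_singleton_iff) (auto simp: T_def)
  qed (use fin in simp)
  also have "int (card (insert {} ((\<lambda>l. {l}) ` L))) \<le> 1 + b"
  proof -
    have "card ((\<lambda>l. {l}) ` L) \<le> card L" using fin by (intro card_image_le)
    then show ?thesis using fin by (subst card_insert_disjoint) (auto simp: b_def)
  qed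
  finally have n1: "n1 \<le> 2 * int q" using ab by linarith

  have sum_t: "(\<Sum>x\<in>X. t x) \<le> b * (int q + 1)"
  proof -
    have "(\<Sum>x\<in>X. card (T x)) \<le> (\<Sum>l\<in>L. q + 1)"
      unfolding T_def sum_card_swap[OF fin(1,2)] by (intro sum_mono points_on)
    then have "int (\<Sum>x\<in>X. card (T x)) \<le> int (card L * (q + 1))"
      by (simp only: of_nat_le_iff sum_constant of_nat_id)
    then show ?thesis by (simp add: t_def b_def algebra_simps)
  qed
  have pred: "int (k * (k - 1)) = int k * (int k - 1)" for k :: nat
    by (cases k) (auto simp: algebra_simps)
  have sum_tt: "b * (b - 1) \<le> (\<Sum>x\<in>X. t x * (t x - 1))"
  proof -
    have "int (card L * (card L - 1)) \<le> int (\<Sum>x\<in>X. card (T x) * (card (T x) - 1))"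
      unfolding T_def of_nat_le_iff using fin(1,2) meet by (rule sum_degree_mult_pred_ge)
    then show ?thesis unfolding of_nat_sum pred by (simp add: t_def b_def)
  qed

  \<comment> \<open>Since \<open>t(t - 1) - 2 = (t + 1)(t - 2)\<close> and
    \<open>t \<le> q + 1\<close>, the first term suffices for \<open>t \<ge> 2\<close>. The
    coefficients \<open>q\<close> and \<open>q + 2\<close> of the indicators are chosen to give
    equality at \<open>t = 1\<close> and \<open>t = 0\<close>.\<close>
  have "(\<Sum>x\<in>X. t x * (t x - 1) - 2) \<le>
      (\<Sum>x\<in>X. (int q + 2) * (t x - 2) + int q * (if t x \<le> 1 then 1 else 0)
                + (int q + 2) * (if t x = 0 then 1 else 0))"
  proof (rule sum_mono)
    fix x assume x: "x \<in> X"
    have le: "t x \<le> int q + 1" "t x \<ge> 0"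
      using lines_through[OF x] by (auto simp: t_def T_def)
    consider "t x = 0" | "t x = 1" | "t x \<ge> 2" using le by linarith
    then show "t x * (t x - 1) - 2 \<le> (int q + 2) * (t x - 2) + int q * (if t x \<le> 1 then 1 else 0)
                + (int q + 2) * (if t x = 0 then 1 else 0)"
    proof cases
      case 3
      have "(t x + 1) * (t x - 2) \<le> (int q + 2) * (t x - 2)"
        using 3 le by (intro mult_right_mono) auto
      then show ?thesis using 3 by (simp add: algebra_simps)
    qed auto
  qed
  also have "\<dots> = (int q + 2) * ((\<Sum>x\<in>X. t x) - 2 * int (card X)) + int q * n1 + (int q + 2) * n0"
    using fin by (simp add: sum.distrib sum_subtractf sum_distrib_left[symmetric] n0_def n1_def
        sum.If_cases Int_def)
  also have "(\<Sum>x\<in>X. t x * (t x - 1) - 2) = (\<Sum>x\<in>X. t x * (t x - 1)) - 2 * int (card X)"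
    by (simp add: sum_subtractf)
  finally have *: "(\<Sum>x\<in>X. t x * (t x - 1)) - 2 * int (card X) \<le>
      (int q + 2) * ((\<Sum>x\<in>X. t x) - 2 * int (card X)) + int q * n1 + (int q + 2) * n0" .

  define Q where "Q = int q"
  have Q: "Q \<ge> 3" using q by (simp add: Q_def)
  \<comment> \<open>The number \<open>c\<close> bounds \<open>a\<close> and measures how far
    \<open>b\<close> falls short of \<open>2Q - 1\<close>. Replacing \<open>b\<close> by
    \<open>2Q - 1 - c\<close> leaves a polynomial in \<open>Q\<close> and \<open>c\<close> with
    visible signs.\<close>
  define c where "c = 2 * Q - 1 - b"
  have c: "a \<le> c" "c \<ge> 0" using ab by (auto simp: c_def Q_def)
  have "int (q\<^sup>2 + q + 1) \<le> int (card X)" using card_X by (simp only: of_nat_le_iff)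
  then have X: "Q * Q + Q + 1 \<le> int (card X)" by (simp add: Q_def power2_eq_square)
  have "b * (b - 1) \<le> 2 * int (card X)
      + (Q + 2) * ((\<Sum>x\<in>X. t x) - 2 * int (card X)) + Q * n1 + (Q + 2) * n0"
    using * sum_tt unfolding Q_def by linarith
  also have "\<dots> = (Q + 2) * (\<Sum>x\<in>X. t x) - (2 * Q + 2) * int (card X) + Q * n1 + (Q + 2) * n0"
    by (simp add: algebra_simps)
  \<comment> \<open>The coefficient of \<open>card X\<close> is now negative, so its lower bound is
    the one that applies.\<close>
  also have "\<dots> \<le> (Q + 2) * (b * (Q + 1)) - (2 * Q + 2) * (Q * Q + Q + 1)
      + Q * (2 * Q) + (Q + 2) * (c + 1)"
    using sum_t X n1 n0 Q c
    by (intro add_mono diff_mono mult_left_mono) (auto simp: Q_def)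
  finally have "(Q - 2) * (Q - 2) + c * ((Q - 1) * (Q - 1) + 2) + c * c \<le> 0"
    unfolding c_def by (simp add: algebra_simps)
  moreover have "(Q - 2) * (Q - 2) > 0" "c * ((Q - 1) * (Q - 1) + 2) \<ge> 0" "c * c \<ge> 0"
    using Q c by auto
  ultimately show False by linarith
qed

section \<open>Decision trees\<close>

text \<open>The candidates are queried one at a time; the last is found by elimination, which saves
  one query. The antichain condition makes a query of \<open>p\<close> answer YES for
  \<open>p\<close> alone.\<close>

lemma search_among_candidates:
  assumes "finite C" and antichain: "\<And>u v. u \<in> C \<Longrightarrow> v \<in> C \<Longrightarrow> u \<subseteq> v \<Longrightarrow> u = v"
  shows "\<exists>s. queries s \<subseteq> C \<and> (\<forall>v\<in>C. outcome s v = v \<and> num_queries s v \<le> card C - 1)"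
  using assms
proof (induction C rule: finite_induct)
  case empty
  show ?case by (rule exI[of _ "Announce {}"]) simp
next
  case (insert p C)
  then obtain s where s: "queries s \<subseteq> C"
      "\<forall>v\<in>C. outcome s v = v \<and> num_queries s v \<le> card C - 1" by auto
  show ?case
  proof (cases "C = {}")
    case True
    then show ?thesis by (intro exI[of _ "Announce p"]) simp
  next
    case False
    then have "card C > 0" using insert by (simp add: card_gt_0_iff)
    moreover have "v \<subseteq> p \<longleftrightarrow> v = p" if "v \<in> insert p C" for v
      using insert.prems[of v p] that by auto
    ultimately have "outcome (Ask p (Announce p) s) v = v \<and>
        num_queries (Ask p (Announce p) s) v \<le> card (insert p C) - 1" if "v \<in> insert p C" for v
      using s(2) insert.hyps that by (cases "v = p") auto
    then show ?thesis using s(1)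
      by (intro exI[of _ "Ask p (Announce p) s"]) auto
  qed
qed

text \<open>Blocks are queried until the first YES, then the candidates in that block. The last
  block is never queried, as it must contain every remaining candidate. The induction varies
  \<open>C\<close> because a NO removes all candidates lying in the block.\<close>

lemma search_among_blocks:
  assumes "finite B" and "finite C" and antichain: "\<And>u v. u \<in> C \<Longrightarrow> v \<in> C \<Longrightarrow> u \<subseteq> v \<Longrightarrow> u = v"
    and "\<And>v. v \<in> C \<Longrightarrow> \<exists>l\<in>B. v \<subseteq> l"
    and "\<And>l. l \<in> B \<Longrightarrow> card {v\<in>C. v \<subseteq> l} \<le> m"
  shows "\<exists>s. queries s \<subseteq> B \<union> C \<and>
    (\<forall>v\<in>C. outcome s v = v \<and> num_queries s v \<le> (card B - 1) + (m - 1))"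
  using assms
proof (induction B arbitrary: C rule: finite_induct)
  case empty
  then show ?case by (intro exI[of _ "Announce {}"]) auto
next
  case (insert l B)
  let ?Y = "{v\<in>C. v \<subseteq> l}" and ?N = "{v\<in>C. \<not> v \<subseteq> l}"
  obtain s where s: "queries s \<subseteq> ?Y"
      "\<forall>v\<in>?Y. outcome s v = v \<and> num_queries s v \<le> card ?Y - 1"
    using search_among_candidates[of ?Y] insert.prems by auto
  have s': "\<forall>v\<in>?Y. num_queries s v \<le> m - 1"
    using s(2) insert.prems(4)[of l] by fastforce
  show ?case
  proof (cases "B = {}")
    case True
    then have "?Y = C" using insert.prems(3) by auto
    then show ?thesis using s s' by (intro exI[of _ s]) auto
  next
    case False
    have "\<exists>s. queries s \<subseteq> B \<union> ?N \<and>
      (\<forall>v\<in>?N. outcome s v = v \<and> num_queries s v \<le> (card B - 1) + (m - 1))"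
    proof (rule insert.IH)
      fix k assume "k \<in> B"
      have "card {v \<in> ?N. v \<subseteq> k} \<le> card {v \<in> C. v \<subseteq> k}"
        using insert.prems(1) by (intro card_mono) auto
      also have "\<dots> \<le> m" using insert.prems(4) \<open>k \<in> B\<close> by blast
      finally show "card {v \<in> ?N. v \<subseteq> k} \<le> m" .
    qed (use insert.prems in auto)
    then obtain r where r: "queries r \<subseteq> B \<union> ?N"
      "\<forall>v\<in>?N. outcome r v = v \<and> num_queries r v \<le> (card B - 1) + (m - 1)" by blast
    \<comment> \<open>After YES on \<open>l\<close> the cost is at most \<open>1 + (m - 1)\<close>,
      which is within the bound because another block remains.\<close>
    have B: "card (insert l B) - 1 = card B" "card B > 0"
      using False insert.hyps by (auto simp: card_gt_0_iff)
    have "outcome (Ask l s r) v = v \<and> num_queries (Ask l s r) v \<le> card B + (m - 1)"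
      if "v \<in> C" for v
    proof (cases "v \<subseteq> l")
      case True
      then show ?thesis using s(2) s' B that by fastforce
    next
      case False
      then have "num_queries r v \<le> (card B - 1) + (m - 1)" "outcome r v = v"
        using r(2) that by auto
      then show ?thesis using False B by simp
    qed
    then show ?thesis using s(1) r(1) unfolding B
      by (intro exI[of _ "Ask l s r"]) auto
  qed
qed

section \<open>Vector spaces over a finite field\<close>

text \<open>Adjoining an independent \<open>x\<close> multiplies the size of the span by that of the
  field: a vector of the new span is \<open>scale k x + y\<close> for exactly one pair of a scalar
  \<open>k\<close> and a \<open>y\<close> in the old span.\<close>

lemma (in vector_space) card_span_independent:
  assumes "finite B" "independent B"
  shows "card (span B) = CARD('a) ^ card B"
  using assms
proof (induction B rule: finite_induct)
  case empty
  then show ?case by simp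
next
  case (insert x B)
  have ind: "independent B" "x \<notin> span B"
    using insert by (auto simp: independent_insert)
  have "bij_betw (\<lambda>(k, y). scale k x + y) (UNIV \<times> span B) (span (insert x B))"
    unfolding bij_betw_def
  proof
    show "inj_on (\<lambda>(k, y). scale k x + y) (UNIV \<times> span B)"
    proof (rule inj_onI, clarify)
      fix k y l z
      assume y: "y \<in> span B" "z \<in> span B" and eq: "scale k x + y = scale l x + z"
      have "scale (k - l) x = z - y"
        using eq by (simp add: scale_left_diff_distrib algebra_simps)
      then have "scale (k - l) x \<in> span B" using y by (simp add: span_diff)
      then have "k = l"
        using ind(2) span_scale[of "scale (k - l) x" B "inverse (k - l)"]
        by (cases "k - l = 0") auto
      then show "k = l \<and> y = z" using eq by simp
    qed
    show "(\<lambda>(k, y). scale k x + y) ` (UNIV \<times> span B) = span (insert x B)"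
      unfolding span_insert
    proof (intro equalityI subsetI)
      fix v assume "v \<in> {v. \<exists>k. v - scale k x \<in> span B}"
      then obtain k where "v - scale k x \<in> span B" by blast
      then show "v \<in> (\<lambda>(k, y). scale k x + y) ` (UNIV \<times> span B)"
        by (intro image_eqI[of _ _ "(k, v - scale k x)"]) auto
    next
      fix v assume "v \<in> (\<lambda>(k, y). scale k x + y) ` (UNIV \<times> span B)"
      then obtain k y where "v = scale k x + y" "y \<in> span B" by auto
      then have "v - scale k x \<in> span B" by simp
      then show "v \<in> {v. \<exists>k. v - scale k x \<in> span B}" by blast
    qed
  qed
  then have "card (span (insert x B)) = card ((UNIV :: 'a set) \<times> span B)"
    by (metis bij_betw_same_card)
  then show ?case using insert.IH[OF ind(1)] insert.hyps
    by (simp add: card_cartesian_product)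
qed

section \<open>The projective plane of a three-dimensional space\<close>

locale finite_field_vector_space_3 = vector_space scale
  for scale :: "'a::{field,finite} \<Rightarrow> 'b::ab_group_add \<Rightarrow> 'b" +
  fixes q :: nat
  assumes card_field: "CARD('a) = q"
    and dim_UNIV: "dim (UNIV :: 'b set) = 3"
begin

abbreviation (input) "points \<equiv> one_subspaces scale"

definition lines :: "'b set set" where
  "lines = {U. subspace U \<and> dim U = 2}"

lemma q_ge_2: "q \<ge> 2"
proof -
  have "card {0, 1 :: 'a} \<le> q" unfolding card_field[symmetric] by (rule card_mono) auto
  then show ?thesis by simp
qed

lemma finite_card_UNIV: "finite (UNIV :: 'b set) \<and> CARD('b) = q ^ 3"
proof -
  obtain B :: "'b set" where B: "independent B" "UNIV \<subseteq> span B" "card B = 3"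
    using basis_exists[of UNIV] dim_UNIV by auto
  \<comment> \<open>An infinite set has \<open>card\<close> equal to 0, so a nonzero value proves
    finiteness.\<close>
  then have "finite B" using card.infinite by fastforce
  then have "card (span B) = q ^ 3" using card_span_independent B card_field by simp
  moreover have "span B = UNIV" using B by auto
  ultimately show ?thesis using q_ge_2 card.infinite by fastforce
qed

lemma finite_vectors [simp]: "finite (A :: 'b set)"
  using finite_card_UNIV by (rule finite_subset[OF subset_UNIV conjunct1])

lemma finite_vector_sets [simp]: "finite (F :: 'b set set)"
proof -
  have "finite (Pow (UNIV :: 'b set))" by (subst finite_Pow_iff) (rule finite_vectors)
  then show ?thesis by (rule rev_finite_subset) auto
qed

lemma card_subspace:
  assumes "subspace U"
  shows "card U = q ^ dim U"
proof -
  obtain B where B: "B \<subseteq> U" "independent B" "U \<subseteq> span B" "card B = dim U"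
    using basis_exists[of U] by auto
  then have "span B = U" using span_minimal[OF _ assms] by blast
  then show ?thesis using card_span_independent[of B] B card_field by simp
qed

lemma subspace_point: "p \<in> points \<Longrightarrow> subspace p"
  and card_point: "p \<in> points \<Longrightarrow> card p = q"
  using card_subspace[of p] by (simp_all add: one_subspaces_def)

lemma subspace_line: "l \<in> lines \<Longrightarrow> subspace l"
  and card_line: "l \<in> lines \<Longrightarrow> card l = q\<^sup>2"
  using card_subspace[of l] by (simp_all add: lines_def)

lemma span_singleton_point:
  assumes "x \<noteq> 0"
  shows "span {x} \<in> points"
proof -
  have "independent {x}" using assms by simp
  then have "dim (span {x}) = 1" using dim_span_eq_card_independent[of "{x}"] by simp
  then show ?thesis by (simp add: one_subspaces_def)
qed

lemma point_eq_span:
  assumes "p \<in> points" "x \<in> p" "x \<noteq> 0"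
  shows "p = span {x}"
proof -
  have "span {x} \<subseteq> p"
    using assms subspace_point by (intro span_minimal) auto
  moreover have "card (span {x}) = card p"
    using assms span_singleton_point card_point by metis
  ultimately show ?thesis by (metis card_subset_eq finite_vectors)
qed

lemma point_subset_point_iff:
  assumes "u \<in> points" "v \<in> points"
  shows "u \<subseteq> v \<longleftrightarrow> u = v"
proof
  assume "u \<subseteq> v"
  then show "u = v"
    by (rule card_subset_eq[OF finite_vectors]) (simp add: card_point assms)
qed simp

text \<open>The points in \<open>U\<close>, with 0 removed, partition the nonzero vectors of
  \<open>U\<close> into classes of size \<open>q - 1\<close>.\<close>

lemma card_points_in_subspace:
  assumes "subspace U"
  shows "(q - 1) * card {p \<in> points. p \<subseteq> U} = card U - 1"
proof -
  let ?P = "{p \<in> points. p \<subseteq> U}"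
  have "(\<Union>p\<in>?P. p - {0}) = U - {0}"
  proof (intro equalityI subsetI)
    fix x assume "x \<in> U - {0}"
    moreover from this have "span {x} \<subseteq> U" using assms by (intro span_minimal) auto
    ultimately show "x \<in> (\<Union>p\<in>?P. p - {0})"
      using span_singleton_point[of x] span_base[of x "{x}"] by auto
  qed auto
  moreover have "card (\<Union>p\<in>?P. p - {0}) = (\<Sum>p\<in>?P. card (p - {0}))"
  proof (rule card_UN_disjoint)
    show "\<forall>u\<in>?P. \<forall>v\<in>?P. u \<noteq> v \<longrightarrow> (u - {0}) \<inter> (v - {0}) = {}"
      using point_eq_span by blast
  qed auto
  moreover have "card (p - {0}) = q - 1" if "p \<in> ?P" for p
    using that card_point subspace_0[OF subspace_point] by simp
  moreover have "card (U - {0}) = card U - 1"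
    using subspace_0[OF assms] by simp
  ultimately show ?thesis by (simp add: mult.commute)
qed

lemma card_points_in_line:
  assumes "l \<in> lines"
  shows "card {p \<in> points. p \<subseteq> l} = q + 1"
proof -
  have "(q - 1) * card {p \<in> points. p \<subseteq> l} = q\<^sup>2 - 1"
    using card_points_in_subspace card_line subspace_line assms by metis
  also have "\<dots> = (q - 1) * (q + 1)"
    by (simp add: power2_eq_square algebra_simps)
  finally show ?thesis using q_ge_2 by (subst (asm) mult_cancel1) auto
qed

lemma card_points: "card points = q\<^sup>2 + q + 1"
proof -
  have "(q - 1) * card {p \<in> points. p \<subseteq> UNIV} = q ^ 3 - 1"
    using card_points_in_subspace[OF subspace_UNIV] finite_card_UNIV by simp
  also have "\<dots> = (q - 1) * (q\<^sup>2 + q + 1)"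
  proof -
    obtain r where "q = Suc r" using q_ge_2 by (cases q) auto
    then show ?thesis by (simp add: power2_eq_square power3_eq_cube algebra_simps)
  qed
  finally show ?thesis using q_ge_2 by (subst (asm) mult_cancel1) auto
qed

lemma span_insert_point:
  assumes "p \<in> points" "x \<notin> p"
  shows "span (insert x p) \<in> lines"
proof -
  have "card p = q" using assms card_point by simp
  then have "p \<noteq> {0}" using q_ge_2 by auto
  then obtain y where y: "y \<in> p" "y \<noteq> 0" using subspace_0[OF subspace_point[OF assms(1)]] by blast
  have p: "p = span {y}" using point_eq_span assms y by simp
  have "independent {x, y}" using assms y p by (auto simp: independent_insert)
  moreover have "x \<noteq> y" using assms y by auto
  moreover have "span (insert x p) = span {x, y}"
    unfolding p span_insert[of x "span {y}"] span_insert[of x "{y}"] span_span ..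
  ultimately show ?thesis
    using dim_span_eq_card_independent[of "{x, y}"] by (simp add: lines_def)
qed

text \<open>The span lies in \<open>l\<close> and both have \<open>q\<^sup>2\<close> vectors.
  Consequently two distinct lines through \<open>p\<close> share no vector outside
  \<open>p\<close>.\<close>

lemma line_eq_span:
  assumes "l \<in> lines" "p \<in> points" "p \<subseteq> l" "x \<in> l" "x \<notin> p"
  shows "l = span (insert x p)"
proof -
  have "span (insert x p) \<subseteq> l"
    using assms subspace_line by (intro span_minimal) auto
  moreover have "card (span (insert x p)) = card l"
    using assms span_insert_point card_line by metis
  ultimately show ?thesis by (metis card_subset_eq finite_vectors)
qed

text \<open>If the lines shared only the zero vector, addition would embed
  \<open>l \<times> m\<close>, of size \<open>q ^ 4\<close>, into a space of size
  \<open>q ^ 3\<close>.\<close>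

lemma lines_meet:
  assumes "l \<in> lines" "m \<in> lines"
  shows "\<exists>p\<in>points. p \<subseteq> l \<and> p \<subseteq> m"
proof -
  have sub: "subspace l" "subspace m" using assms subspace_line by auto
  have "\<exists>x. x \<in> l \<inter> m \<and> x \<noteq> 0"
  proof (rule ccontr)
    assume no: "\<not> ?thesis"
    have "inj_on (\<lambda>(x, y). x + y) (l \<times> m)"
    proof (rule inj_onI, clarify)
      fix x y x' y'
      assume *: "x \<in> l" "y \<in> m" "x' \<in> l" "y' \<in> m" "x + y = x' + y'"
      have eq: "x - x' = y' - y" using *(5) by (simp add: algebra_simps)
      have "x - x' \<in> l" using * sub subspace_diff by blast
      moreover have "x - x' \<in> m" unfolding eq using * sub subspace_diff by blast
      ultimately have "x - x' = 0" using no by blast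
      then show "x = x' \<and> y = y'" using eq by simp
    qed
    then have "card (l \<times> m) \<le> card (UNIV :: 'b set)"
      by (rule card_inj_on_le) auto
    then have "q ^ 4 \<le> q ^ 3"
      using finite_card_UNIV card_line assms
      by (simp add: card_cartesian_product power_add[symmetric])
    then show False using q_ge_2 power_strict_increasing[of 3 4 q] by simp
  qed
  then obtain x where "x \<in> l" "x \<in> m" "x \<noteq> 0" by auto
  then show ?thesis
    using span_singleton_point[of x] sub
    by (intro bexI[of _ "span {x}"]) (auto intro: span_minimal[THEN subsetD])
qed

text \<open>With \<open>p\<close> removed, the lines are disjoint sets of
  \<open>q\<^sup>2 - q\<close> vectors each, inside a set of
  \<open>q ^ 3 - q = (q + 1)(q\<^sup>2 - q)\<close> vectors.\<close>

lemma card_lines_through_point: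
  assumes p: "p \<in> points" and K: "\<And>l. l \<in> K \<Longrightarrow> l \<in> lines \<and> p \<subseteq> l"
  shows "card K \<le> q + 1"
proof -
  have "card K * (q\<^sup>2 - q) = (\<Sum>l\<in>K. card (l - p))"
    using K card_line card_point[OF p] by (simp add: card_Diff_subset)
  also have "\<dots> = card (\<Union>l\<in>K. l - p)"
  proof (rule card_UN_disjoint[symmetric])
    show "\<forall>l\<in>K. \<forall>m\<in>K. l \<noteq> m \<longrightarrow> (l - p) \<inter> (m - p) = {}"
      using line_eq_span p K by blast
  qed auto
  also have "\<dots> \<le> card (UNIV - p)"
    by (intro card_mono) auto
  also have "\<dots> = q ^ 3 - q"
    using finite_card_UNIV card_point[OF p] by (simp add: card_Diff_subset)
  also have "\<dots> = (q + 1) * (q\<^sup>2 - q)"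
    by (simp add: power2_eq_square power3_eq_cube algebra_simps diff_mult_distrib2)
  finally show ?thesis
    using q_ge_2 by (subst (asm) mult_le_cancel2) (auto simp: power2_eq_square)
qed

section \<open>Upper bound for adaptive search\<close>

lemma point_exists: "\<exists>p. p \<in> points"
proof (rule ccontr)
  assume "\<not> ?thesis"
  then have "points = {}" by blast
  then show False using card_points by simp
qed

lemma adaptive_number_le: "adaptive_number scale \<le> 2 * q - 1"
proof -
  obtain p where p: "p \<in> points" using point_exists by blast
  define K where "K = {l \<in> lines. p \<subseteq> l}"
  have cover: "\<exists>l\<in>K. v \<subseteq> l" if v: "v \<in> points" for v
  proof -
    obtain x where x: "x \<notin> p" "v \<subseteq> span (insert x p)"
    proof (cases "v = p")
      case True
      have "card p < CARD('b)"
        using finite_card_UNIV card_point[OF p] q_ge_2 power_strict_increasing[of 1 3 q] by simp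
      then obtain x where "x \<notin> p" by (metis UNIV_eq_I less_irrefl)
      then show ?thesis using that[of x] True span_superset by blast
    next
      case False
      then obtain x where x: "x \<in> v" "x \<notin> p" using point_subset_point_iff[OF v p] by blast
      then have "x \<noteq> 0" using subspace_0[OF subspace_point[OF p]] by auto
      then have "v = span {x}" using point_eq_span v x by simp
      then show ?thesis using that[of x] x span_mono[of "{x}" "insert x p"] by auto
    qed
    moreover have "p \<subseteq> span (insert x p)" using span_superset by blast
    ultimately show ?thesis using span_insert_point[OF p] by (auto simp: K_def)
  qed
  then obtain l where l: "l \<in> K" using p by blast
  let ?Y = "{v\<in>points. v \<subseteq> l}" and ?N = "{v\<in>points. \<not> v \<subseteq> l}"
  have "\<exists>s. queries s \<subseteq> ?Y \<and> (\<forall>v\<in>?Y. outcome s v = v \<and> num_queries s v \<le> card ?Y - 1)"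
    by (rule search_among_candidates) (auto simp: point_subset_point_iff)
  moreover have "card ?Y = q + 1" using l card_points_in_line by (auto simp: K_def)
  ultimately obtain s where s: "queries s \<subseteq> ?Y"
    "\<forall>v\<in>?Y. outcome s v = v \<and> num_queries s v \<le> q" by auto
  \<comment> \<open>After NO on \<open>l\<close> the point \<open>p\<close> is excluded, so each of
    the at most \<open>q\<close> other lines of \<open>K\<close> holds at most \<open>q\<close>
    candidates. The total is \<open>1 + (q - 1) + (q - 1)\<close>; the YES branch costs
    \<open>1 + q\<close>, which is no more since \<open>q \<ge> 2\<close>.\<close>
  have "\<exists>r. queries r \<subseteq> (K - {l}) \<union> ?N \<and>
    (\<forall>v\<in>?N. outcome r v = v \<and> num_queries r v \<le> (card (K - {l}) - 1) + (q - 1))"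
  proof (rule search_among_blocks)
    fix m assume m: "m \<in> K - {l}"
    have "card {v\<in>?N. v \<subseteq> m} \<le> card ({v\<in>points. v \<subseteq> m} - {p})"
      using l by (intro card_mono) (auto simp: K_def)
    also have "\<dots> = q" using m p card_points_in_line[of m] by (simp add: K_def)
    finally show "card {v\<in>?N. v \<subseteq> m} \<le> q" .
  qed (use cover in \<open>auto simp: point_subset_point_iff\<close>)
  then obtain r where r: "queries r \<subseteq> (K - {l}) \<union> ?N"
    "\<forall>v\<in>?N. outcome r v = v \<and> num_queries r v \<le> (card (K - {l}) - 1) + (q - 1)" by blast
  have "card K \<le> q + 1" by (rule card_lines_through_point[OF p]) (simp add: K_def)
  then have cardK: "card (K - {l}) \<le> q" using l by simp
  have main: "outcome (Ask l s r) v = v \<and> num_queries (Ask l s r) v \<le> 2 * q - 1"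
    if v: "v \<in> points" for v
  proof (cases "v \<subseteq> l")
    case True
    then have "outcome s v = v" "num_queries s v \<le> q" using s(2) v by auto
    then show ?thesis using True q_ge_2 by simp
  next
    case False
    then have "outcome r v = v" "num_queries r v \<le> (card (K - {l}) - 1) + (q - 1)"
      using r(2) v by auto
    then show ?thesis using False q_ge_2 cardK by simp
  qed
  have "queries (Ask l s r) \<subseteq> lines \<union> points" using s(1) r(1) l by (auto simp: K_def)
  then have "finds_all scale (Ask l s r)"
    unfolding finds_all_def using main subspace_line subspace_point by blast
  then show ?thesis
    unfolding adaptive_number_def using main by (intro Least_le) blast
qed

section \<open>Lower bound for non-adaptive search\<close>

lemma card_separating_ge:
  assumes q3: "q \<ge> 3" and sub: "\<And>U. U \<in> F \<Longrightarrow> subspace U" and sep: "separating scale F"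
  shows "2 * q \<le> card F"
proof -
  let ?L = "F \<inter> lines" and ?P = "F \<inter> points"
  \<comment> \<open>These two subspaces answer alike for all points, so all separation is done by
    points and lines.\<close>
  have trivial: "U = {0} \<or> U = UNIV" if "U \<in> F" "U \<notin> lines" "U \<notin> points" for U
  proof -
    have U: "subspace U" "card U = q ^ dim U" using sub that card_subspace by auto
    have "card U \<le> CARD('b)" by (rule card_mono) auto
    then have "dim U \<le> 3"
      using U finite_card_UNIV q_ge_2 power_le_imp_le_exp[of q "dim U" 3] by simp
    moreover have "dim U \<noteq> 1" "dim U \<noteq> 2"
      using that U by (auto simp: lines_def one_subspaces_def)
    ultimately consider "dim U = 0" | "dim U = 3" by linarith
    then show ?thesis
    proof cases
      case 1
      then have "card U = 1" using U by simp
      then show ?thesis using subspace_0[OF U(1)] by (auto simp: card_1_singleton_iff)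
    next
      case 2
      then have "card U = CARD('b)" using U finite_card_UNIV by simp
      then show ?thesis using card_subset_eq[of UNIV U] by simp
    qed
  qed
  have "2 * q \<le> card ?P + card ?L"
  proof (rule separating_points_and_lines_ge[of points _ _ _ "(\<subseteq>)"])
    show "card {l \<in> ?L. p \<subseteq> l} \<le> q + 1" if "p \<in> points" for p
      using that by (intro card_lines_through_point) auto
    \<comment> \<open>A query point answers YES only for itself, so two points outside
      \<open>?P\<close> can be told apart only by a line.\<close>
    show "inj_on (\<lambda>x. {l \<in> ?L. x \<subseteq> l}) (points - ?P)"
    proof (rule inj_onI, rule ccontr)
      fix u v assume uv: "u \<in> points - ?P" "v \<in> points - ?P" "u \<noteq> v"
        and eq: "{l \<in> ?L. u \<subseteq> l} = {l \<in> ?L. v \<subseteq> l}"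
      obtain U where U: "U \<in> F" "(u \<subseteq> U) \<noteq> (v \<subseteq> U)"
        using sep uv unfolding separating_def by blast
      have "U \<notin> lines" using eq U by blast
      moreover have "U \<notin> points" using U uv point_subset_point_iff by blast
      ultimately have "U = {0} \<or> U = UNIV" using trivial U by blast
      moreover have "\<not> w \<subseteq> {0}" if "w \<in> points" for w
        using card_mono[of "{0}" w] card_point[OF that] q_ge_2 by auto
      ultimately show False using U uv by blast
    qed
  qed (use q3 card_points card_points_in_line lines_meet in auto)
  also have "\<dots> = card (?P \<union> ?L)"
    by (rule card_Un_disjoint[symmetric]) (auto simp: lines_def one_subspaces_def)
  also have "\<dots> \<le> card F" by (rule card_mono) auto
  finally show ?thesis .
qed

text \<open>This provides the witness that makes the minimum in \<open>nonadaptive_number\<close>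
  attained, so that \<open>LeastI\<close> applies.\<close>

lemma separating_points: "separating scale points"
  unfolding separating_def
proof (intro ballI impI)
  fix u v assume "u \<in> points" "v \<in> points" "u \<noteq> v"
  then show "\<exists>U\<in>points. (u \<subseteq> U) \<noteq> (v \<subseteq> U)"
    using point_subset_point_iff[of v u] by (intro bexI[of _ u]) simp_all
qed

lemma nonadaptive_number_ge:
  assumes "q \<ge> 3"
  shows "2 * q \<le> nonadaptive_number scale"
proof -
  let ?S = "\<lambda>k. \<exists>F. finite F \<and> card F = k \<and> (\<forall>U\<in>F. subspace U) \<and> separating scale F"
  have "finite points \<and> card points = card points \<and>
      (\<forall>U\<in>points. subspace U) \<and> separating scale points"
    using separating_points subspace_point finite_vector_sets by blast
  then have "?S (card points)" by (rule exI)
  then have "?S (nonadaptive_number scale)"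
    unfolding nonadaptive_number_def by (rule LeastI)
  then obtain F where "card F = nonadaptive_number scale" "\<forall>U\<in>F. subspace U" "separating scale F"
    by blast
  then show ?thesis using card_separating_ge[OF assms, of F] by simp
qed

end

theorem theorem1p2:
  fixes smul :: "'k::{field,finite} \<Rightarrow> 'v::ab_group_add \<Rightarrow> 'v"
    and q :: nat
  assumes "primepow q" and "q \<ge> 9"
    and "CARD('k) = q"
    and "vector_space smul"
    and "vector_space.dim smul (UNIV :: 'v set) = 3"
  shows "adaptive_number smul < nonadaptive_number smul"
proof -
  have "finite_field_vector_space_3_axioms smul q"
    by (rule finite_field_vector_space_3_axioms.intro) (fact assms)+
  with assms(4) interpret finite_field_vector_space_3 smul q
    by (rule finite_field_vector_space_3.intro)
  have "adaptive_number smul \<le> 2 * q - 1" by (rule adaptive_number_le)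
  also have "\<dots> < 2 * q" using assms(2) by simp
  also have "\<dots> \<le> nonadaptive_number smul" by (rule nonadaptive_number_ge) (use assms(2) in simp)
  finally show ?thesis .
qed

end
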